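(* The linear span of all $\mathbb{D}_0$-cliques satisfying the gravity condition forms a suboperad of $\mathsf{C}\mathbb{D}_0$ isomorphic to $\mathsf{Grav}$. Moreover, $\phi_{\mathsf{Grav}}$ is an isomorphism between these two operads (from $\mathsf{Grav}$ to this suboperad).
   Context: Let $\mathbb{K}$ be a field of characteristic zero and $[n]=\{1,\dots,n\}$. Operads are nonsymmetric operads in $\mathbb{K}$-vector spaces (graded from arity $1$, with partial compositions $\circ_i$ and a unit of arity $1$); operad morphisms are linear maps that respect arities, units and partial compositions; a suboperad is a graded subspace containing the unit and closed under partial compositions. For a polygon of size $n\ge1$ with vertex set $[n+1]$, arcs are the pairs $(x,y)$ with $1\le x<y\le n+1$; the arc $(1,n+1)$ is the base; the arcs $(x,x+1)$ different from $(1,n+1)$ are the edges; all other arcs are diagonals. Diagonals $(x,y)$, $(x',y')$ are crossing if $x<x'<y<y'$ or $x'<x<y'<y$. $\mathbb{D}_0=\{\mathbb{1},0\}$ is the unitary magma with unit $\mathbb{1}$ and absorbing element $0$ (so $0\star0=0$). For a unitary magma $\mathcal{M}$ with operation $\star$ and unit $\mathbb{1}_{\mathcal{M}}$, an $\mathcal{M}$-clique of arity $n\ge1$ is a map $\mathfrak{p}$ assigning a label $\mathfrak{p}(x,y)\in\mathcal{M}$ to each arc $(x,y)$, $1\le x<y\le n+1$; by convention the only $\mathcal{M}$-clique of arity $1$ is $\mathbf{u}$, with $\mathbf{u}(1,2)=\mathbb{1}_{\mathcal{M}}$. An arc is solid if its label is not $\mathbb{1}_{\mathcal{M}}$. Write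 $\mathfrak{p}_0:=\mathfrak{p}(1,n+1)$ and $\mathfrak{p}_i:=\mathfrak{p}(i,i+1)$ for $i\in[n]$. $\mathsf{C}\mathcal{M}$ is the operad (with unit $\mathbf{u}$) such that $\mathsf{C}\mathcal{M}(n)$ has basis the $\mathcal{M}$-cliques of arity $n$, and for $\mathcal{M}$-cliques $\mathfrak{p},\mathfrak{q}$ of arities $n,m$ and $i\in[n]$, $\mathfrak{p}\circ_i\mathfrak{q}$ is the $\mathcal{M}$-clique of arity $n+m-1$ with, for $1\le x<y\le n+m$, $$(\mathfrak{p}\circ_i\mathfrak{q})(x,y)=\begin{cases}\mathfrak{p}(x,y)&\text{if }y\le i,\\ \mathfrak{p}(x,y-m+1)&\text{if }x\le i<i+m\le y,\ (x,y)\ne(i,i+m),\\ \mathfrak{p}(x-m+1,y-m+1)&\text{if }i+m\le x,\\ \mathfrak{q}(x-i+1,y-i+1)&\text{if }i\le x<y\le i+m,\ (x,y)\ne(i,i+m),\\ \mathfrak{p}_i\star\mathfrak{q}_0&\text{if }(x,y)=(i,i+m),\\ \mathbb{1}_{\mathcal{M}}&\text{otherwise}.\end{cases}$$ An $\mathcal{M}$-clique $\mathfrak{p}$ satisfies the gravity condition if $\mathfrak{p}=\mathbf{u}$, or all its edges and its base are solid and for all crossing diagonals $(x,y)$ and $(x',y')$ of $\mathfrak{p}$ with $x<x'$, $\mathfrak{p}(x,y)\ne\mathbb{1}_{\mathcal{M}}\ne\mathfrak{p}(x',y')$ implies $\mathfrak{p}(x',y)=\mathbb{1}_{\mathcal{M}}$.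 A gravity chord diagram of size $n\ge2$ is a polygon of size $n$ with a set of arcs declared "labeled" such that all edges and the base are labeled, and whenever $(x,y)$ and $(x',y')$ are labeled crossing diagonals with $x<x'$, the arc $(x',y)$ is not labeled. The operad $\mathsf{Grav}$ is defined by: $\mathsf{Grav}(n)$, $n\ge2$, is the linear span of all gravity chord diagrams of size $n$, and $\mathsf{Grav}(1)$ is the span of the single polygon of size $1$ whose only arc is unlabeled, which is the unit. For gravity chord diagrams $\mathfrak{c},\mathfrak{d}$ of sizes $n,m\ge2$ and $i\in[n]$, $\mathfrak{c}\circ_i\mathfrak{d}$ is the gravity chord diagram of size $n+m-1$ obtained by gluing the base $(1,m+1)$ of $\mathfrak{d}$ onto the $i$th edge $(i,i+1)$ of $\mathfrak{c}$: the vertices $1,\dots,i$ of $\mathfrak{c}$ keep their numbers, the vertices $i+1,\dots,n+1$ of $\mathfrak{c}$ are shifted by $m-1$, the vertices $1,\dots,m+1$ of $\mathfrak{d}$ become $i,\dots,i+m$, and the labeled arcs are exactly the images of the labeled arcs of $\mathfrak{c}$ and $\mathfrak{d}$ (in particular $(i,i+m)$ is labeled). $\phi_{\mathsf{Grav}}:\mathsf{Grav}\to\mathsf{C}\mathbb{D}_0$ is the linear map sending a gravity chord diagram to the $\mathbb{D}_0$-clique of the same arity in which each labeled arc gets label $0$ and each unlabeled arc gets label $\mathbb{1}$. *)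

theory Defs
  imports Complex_Main "HOL-Library.Poly_Mapping" "HOL-Library.FuncSet"
begin

text \<open>
  The homogeneous components are subspaces of one ambient vector space. They need not intersect
  trivially, so partial compositions are indexed by arities: \<open>pcomp n m i x y\<close> is the
  \<open>i\<close>-th partial composition of \<open>x\<close> of arity \<open>n\<close> with \<open>y\<close> of arity \<open>m\<close>. Likewise morphisms are
  families of maps indexed by the arity. Only arities at least 1 are relevant.
\<close>

locale ns_operad = vector_space scale
  for scale :: "'k::field \<Rightarrow> 'v::ab_group_add \<Rightarrow> 'v" +
  fixes Op :: "nat \<Rightarrow> 'v set"
    and unt :: 'v
    and pcomp :: "nat \<Rightarrow> nat \<Rightarrow> nat \<Rightarrow> 'v \<Rightarrow> 'v \<Rightarrow> 'v"
  assumes subspace_Op: "n \<ge> 1 \<Longrightarrow> subspace (Op n)"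
    and unit_closed: "unt \<in> Op 1"
    and pcomp_closed:
      "\<lbrakk>n \<ge> 1; m \<ge> 1; i \<in> {1..n}; x \<in> Op n; y \<in> Op m\<rbrakk> \<Longrightarrow> pcomp n m i x y \<in> Op (n + m - 1)"
    and pcomp_add_left:
      "\<lbrakk>n \<ge> 1; m \<ge> 1; i \<in> {1..n}; x \<in> Op n; x' \<in> Op n; y \<in> Op m\<rbrakk>
        \<Longrightarrow> pcomp n m i (x + x') y = pcomp n m i x y + pcomp n m i x' y"
    and pcomp_add_right:
      "\<lbrakk>n \<ge> 1; m \<ge> 1; i \<in> {1..n}; x \<in> Op n; y \<in> Op m; y' \<in> Op m\<rbrakk>
        \<Longrightarrow> pcomp n m i x (y + y') = pcomp n m i x y + pcomp n m i x y'"
    and pcomp_scale_left: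
      "\<lbrakk>n \<ge> 1; m \<ge> 1; i \<in> {1..n}; x \<in> Op n; y \<in> Op m\<rbrakk>
        \<Longrightarrow> pcomp n m i (scale a x) y = scale a (pcomp n m i x y)"
    and pcomp_scale_right:
      "\<lbrakk>n \<ge> 1; m \<ge> 1; i \<in> {1..n}; x \<in> Op n; y \<in> Op m\<rbrakk>
        \<Longrightarrow> pcomp n m i x (scale a y) = scale a (pcomp n m i x y)"
    and unit_left: "\<lbrakk>n \<ge> 1; x \<in> Op n\<rbrakk> \<Longrightarrow> pcomp 1 n 1 unt x = x"
    and unit_right: "\<lbrakk>n \<ge> 1; i \<in> {1..n}; x \<in> Op n\<rbrakk> \<Longrightarrow> pcomp n 1 i x unt = x"
    and assoc_sequential:
      "\<lbrakk>n \<ge> 1; m \<ge> 1; k \<ge> 1; i \<in> {1..n}; j \<in> {1..m}; x \<in> Op n; y \<in> Op m; z \<in> Op k\<rbrakk>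
        \<Longrightarrow> pcomp (n + m - 1) k (i + j - 1) (pcomp n m i x y) z
          = pcomp n (m + k - 1) i x (pcomp m k j y z)"
    and assoc_parallel:
      "\<lbrakk>n \<ge> 1; m \<ge> 1; k \<ge> 1; i \<in> {1..n}; j \<in> {1..n}; i < j; x \<in> Op n; y \<in> Op m; z \<in> Op k\<rbrakk>
        \<Longrightarrow> pcomp (n + m - 1) k (j + m - 1) (pcomp n m i x y) z
          = pcomp (n + k - 1) m i (pcomp n k j x z) y"

locale suboperad = ns_operad scale Op unt pcomp
  for scale :: "'k::field \<Rightarrow> 'v::ab_group_add \<Rightarrow> 'v" and Op unt pcomp +
  fixes Sub :: "nat \<Rightarrow> 'v set"
  assumes subspace_Sub: "n \<ge> 1 \<Longrightarrow> subspace (Sub n)"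
    and Sub_subset: "n \<ge> 1 \<Longrightarrow> Sub n \<subseteq> Op n"
    and unit_in_Sub: "unt \<in> Sub 1"
    and pcomp_in_Sub:
      "\<lbrakk>n \<ge> 1; m \<ge> 1; i \<in> {1..n}; x \<in> Sub n; y \<in> Sub m\<rbrakk> \<Longrightarrow> pcomp n m i x y \<in> Sub (n + m - 1)"

locale operad_morphism =
  dom: ns_operad scale\<^sub>1 Op\<^sub>1 unt\<^sub>1 pcomp\<^sub>1 + cod: ns_operad scale\<^sub>2 Op\<^sub>2 unt\<^sub>2 pcomp\<^sub>2
  for scale\<^sub>1 :: "'k::field \<Rightarrow> 'v::ab_group_add \<Rightarrow> 'v" and Op\<^sub>1 unt\<^sub>1 pcomp\<^sub>1
    and scale\<^sub>2 :: "'k \<Rightarrow> 'w::ab_group_add \<Rightarrow> 'w" and Op\<^sub>2 unt\<^sub>2 pcomp\<^sub>2 +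
  fixes f :: "nat \<Rightarrow> 'v \<Rightarrow> 'w"
  assumes map_closed: "\<lbrakk>n \<ge> 1; x \<in> Op\<^sub>1 n\<rbrakk> \<Longrightarrow> f n x \<in> Op\<^sub>2 n"
    and map_add: "\<lbrakk>n \<ge> 1; x \<in> Op\<^sub>1 n; y \<in> Op\<^sub>1 n\<rbrakk> \<Longrightarrow> f n (x + y) = f n x + f n y"
    and map_scale: "\<lbrakk>n \<ge> 1; x \<in> Op\<^sub>1 n\<rbrakk> \<Longrightarrow> f n (scale\<^sub>1 a x) = scale\<^sub>2 a (f n x)"
    and map_unit: "f 1 unt\<^sub>1 = unt\<^sub>2"
    and map_pcomp:
      "\<lbrakk>n \<ge> 1; m \<ge> 1; i \<in> {1..n}; x \<in> Op\<^sub>1 n; y \<in> Op\<^sub>1 m\<rbrakk>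
        \<Longrightarrow> f (n + m - 1) (pcomp\<^sub>1 n m i x y) = pcomp\<^sub>2 n m i (f n x) (f m y)"

locale operad_isomorphism = operad_morphism +
  assumes map_bij: "n \<ge> 1 \<Longrightarrow> bij_betw (f n) (Op\<^sub>1 n) (Op\<^sub>2 n)"

definition operads_isomorphic ::
  "('k::field \<Rightarrow> 'v::ab_group_add \<Rightarrow> 'v) \<Rightarrow> (nat \<Rightarrow> 'v set) \<Rightarrow> 'v
    \<Rightarrow> (nat \<Rightarrow> nat \<Rightarrow> nat \<Rightarrow> 'v \<Rightarrow> 'v \<Rightarrow> 'v)
    \<Rightarrow> ('k \<Rightarrow> 'w::ab_group_add \<Rightarrow> 'w) \<Rightarrow> (nat \<Rightarrow> 'w set) \<Rightarrow> 'w
    \<Rightarrow> (nat \<Rightarrow> nat \<Rightarrow> nat \<Rightarrow> 'w \<Rightarrow> 'w \<Rightarrow> 'w) \<Rightarrow> bool"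
  where "operads_isomorphic s\<^sub>1 P u\<^sub>1 c\<^sub>1 s\<^sub>2 Q u\<^sub>2 c\<^sub>2 \<longleftrightarrow>
    (\<exists>f. operad_isomorphism s\<^sub>1 P u\<^sub>1 c\<^sub>1 s\<^sub>2 Q u\<^sub>2 c\<^sub>2 f)"

definition fscale :: "'k::field \<Rightarrow> ('b \<Rightarrow>\<^sub>0 'k) \<Rightarrow> ('b \<Rightarrow>\<^sub>0 'k)"
  where "fscale a v = Poly_Mapping.map ((*) a) v"

lemma lookup_fscale [simp]:
  "Poly_Mapping.lookup (fscale a v) b = a * Poly_Mapping.lookup v b"
  by (simp add: fscale_def Poly_Mapping.map.rep_eq when_def)

interpretation free: vector_space "fscale :: 'k::field \<Rightarrow> ('b \<Rightarrow>\<^sub>0 'k) \<Rightarrow> ('b \<Rightarrow>\<^sub>0 'k)"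
  by standard (auto intro!: poly_mapping_eqI simp: lookup_add algebra_simps)

definition basis_vec :: "'b \<Rightarrow> ('b \<Rightarrow>\<^sub>0 'k::field)"
  where "basis_vec b = Poly_Mapping.single b 1"

definition lin_span :: "'b set \<Rightarrow> ('b \<Rightarrow>\<^sub>0 'k::field) set"
  where "lin_span B = free.span (basis_vec ` B)"

definition linear_ext :: "('b \<Rightarrow> 'c) \<Rightarrow> ('b \<Rightarrow>\<^sub>0 'k::field) \<Rightarrow> ('c \<Rightarrow>\<^sub>0 'k)"
  where "linear_ext g v =
    (\<Sum>b \<in> Poly_Mapping.keys v. fscale (Poly_Mapping.lookup v b) (basis_vec (g b)))"

definition bilinear_ext ::
  "('a \<Rightarrow> 'b \<Rightarrow> 'c) \<Rightarrow> ('a \<Rightarrow>\<^sub>0 'k::field) \<Rightarrow> ('b \<Rightarrow>\<^sub>0 'k) \<Rightarrow> ('c \<Rightarrow>\<^sub>0 'k)"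
  where "bilinear_ext g v w =
    (\<Sum>a \<in> Poly_Mapping.keys v. \<Sum>b \<in> Poly_Mapping.keys w.
      fscale (Poly_Mapping.lookup v a * Poly_Mapping.lookup w b) (basis_vec (g a b)))"

type_synonym arc = "nat \<times> nat"

definition arcs :: "nat \<Rightarrow> arc set"
  where "arcs n = {(x, y). 1 \<le> x \<and> x < y \<and> y \<le> n + 1}"

definition base :: "nat \<Rightarrow> arc"
  where "base n = (1, n + 1)"

definition edges :: "nat \<Rightarrow> arc set"
  where "edges n = {(x, x + 1) |x. x \<in> {1..n}} - {base n}"

definition diagonals :: "nat \<Rightarrow> arc set"
  where "diagonals n = arcs n - edges n - {base n}"

fun crossing :: "arc \<Rightarrow> arc \<Rightarrow> bool"
  where "crossing (x, y) (x', y') \<longleftrightarrow> x < x' \<and> x' < y \<and> y < y' \<or> x' < x \<and> x < y' \<and> y' < y"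

class unitary_magma = one + times +
  assumes magma_unit_left: "1 * a = a"
    and magma_unit_right: "a * 1 = a"

text \<open>
  A clique is determined by its labels on the arcs, so it is a function that is \<open>undefined\<close>
  off the arcs.
\<close>

type_synonym 'm clique = "arc \<Rightarrow> 'm"

definition unit_clique :: "'m::unitary_magma clique"
  where "unit_clique = restrict (\<lambda>_. 1) (arcs 1)"

definition cliques :: "nat \<Rightarrow> 'm::unitary_magma clique set"
  where "cliques n = (if n = 1 then {unit_clique} else arcs n \<rightarrow>\<^sub>E UNIV)"

definition clique_comp ::
  "nat \<Rightarrow> nat \<Rightarrow> nat \<Rightarrow> 'm::unitary_magma clique \<Rightarrow> 'm clique \<Rightarrow> 'm clique"
  where "clique_comp n m i p q = restrict (\<lambda>(x, y).
     if y \<le> i then p (x, y)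
     else if x \<le> i \<and> i + m \<le> y \<and> (x, y) \<noteq> (i, i + m) then p (x, y - m + 1)
     else if i + m \<le> x then p (x - m + 1, y - m + 1)
     else if i \<le> x \<and> y \<le> i + m \<and> (x, y) \<noteq> (i, i + m) then q (x - i + 1, y - i + 1)
     else if (x, y) = (i, i + m) then p (i, i + 1) * q (base m)
     else 1) (arcs (n + m - 1))"

definition C_space :: "nat \<Rightarrow> ('m::unitary_magma clique \<Rightarrow>\<^sub>0 'k::field) set"
  where "C_space n = lin_span (cliques n)"

definition C_unit :: "'m::unitary_magma clique \<Rightarrow>\<^sub>0 'k::field"
  where "C_unit = basis_vec unit_clique"

definition C_comp ::
  "nat \<Rightarrow> nat \<Rightarrow> nat \<Rightarrow> ('m::unitary_magma clique \<Rightarrow>\<^sub>0 'k::field) \<Rightarrow> ('m clique \<Rightarrow>\<^sub>0 'k)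
    \<Rightarrow> ('m clique \<Rightarrow>\<^sub>0 'k)"
  where "C_comp n m i = bilinear_ext (clique_comp n m i)"

definition solid :: "'m::unitary_magma clique \<Rightarrow> arc \<Rightarrow> bool"
  where "solid p a \<longleftrightarrow> p a \<noteq> 1"

definition gravity_condition :: "nat \<Rightarrow> 'm::unitary_magma clique \<Rightarrow> bool"
  where "gravity_condition n p \<longleftrightarrow>
    n = 1 \<and> p = unit_clique \<or>
    (\<forall>a \<in> edges n \<union> {base n}. solid p a) \<and>
    (\<forall>x y x' y'. (x, y) \<in> diagonals n \<and> (x', y') \<in> diagonals n \<and> crossing (x, y) (x', y')
      \<and> x < x' \<and> p (x, y) \<noteq> 1 \<and> p (x', y') \<noteq> 1 \<longrightarrow> p (x', y) = 1)"

definition gravity_space :: "nat \<Rightarrow> ('m::unitary_magma clique \<Rightarrow>\<^sub>0 'k::field) set"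
  where "gravity_space n = lin_span {p \<in> cliques n. gravity_condition n p}"

datatype D0 = D0_unit | D0_zero

instantiation D0 :: "{unitary_magma, mult_zero}"
begin

definition one_D0 :: D0
  where "1 = D0_unit"

definition zero_D0 :: D0
  where "0 = D0_zero"

fun times_D0 :: "D0 \<Rightarrow> D0 \<Rightarrow> D0"
  where "D0_unit * b = b"
  | "D0_zero * b = D0_zero"

instance
proof
  fix a :: D0
  show "1 * a = a" "0 * a = 0"
    by (simp_all add: one_D0_def zero_D0_def)
  show "a * 1 = a" "a * 0 = 0"
    by (cases a; simp add: one_D0_def zero_D0_def)+
qed

end

text \<open>A diagram of size \<open>n\<close> is represented by its set of labeled arcs.\<close>

type_synonym diagram = "arc set"

definition gravity_diagrams :: "nat \<Rightarrow> diagram set"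
  where "gravity_diagrams n =
    (if n = 1 then {{}}
     else {c. edges n \<union> {base n} \<subseteq> c \<and> c \<subseteq> arcs n \<and>
       (\<forall>x y x' y'. (x, y) \<in> c \<inter> diagonals n \<and> (x', y') \<in> c \<inter> diagonals n
         \<and> crossing (x, y) (x', y') \<and> x < x' \<longrightarrow> (x', y) \<notin> c)})"

definition diagram_comp :: "nat \<Rightarrow> nat \<Rightarrow> nat \<Rightarrow> diagram \<Rightarrow> diagram \<Rightarrow> diagram"
  where "diagram_comp n m i c d =
    (if n = 1 then d
     else if m = 1 then c
     else
       (let r = (\<lambda>x. if x \<le> i then x else x + m - 1);
            s = (\<lambda>x. x + i - 1)
        in map_prod r r ` c \<union> map_prod s s ` d))"

definition Grav_space :: "nat \<Rightarrow> (diagram \<Rightarrow>\<^sub>0 'k::field) set"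
  where "Grav_space n = lin_span (gravity_diagrams n)"

definition Grav_unit :: "diagram \<Rightarrow>\<^sub>0 'k::field"
  where "Grav_unit = basis_vec {}"

definition Grav_comp ::
  "nat \<Rightarrow> nat \<Rightarrow> nat \<Rightarrow> (diagram \<Rightarrow>\<^sub>0 'k::field) \<Rightarrow> (diagram \<Rightarrow>\<^sub>0 'k) \<Rightarrow> (diagram \<Rightarrow>\<^sub>0 'k)"
  where "Grav_comp n m i = bilinear_ext (diagram_comp n m i)"

definition clique_of_diagram :: "nat \<Rightarrow> diagram \<Rightarrow> D0 clique"
  where "clique_of_diagram n c = restrict (\<lambda>a. if a \<in> c then 0 else 1) (arcs n)"

definition phi_Grav :: "nat \<Rightarrow> (diagram \<Rightarrow>\<^sub>0 'k::field) \<Rightarrow> (D0 clique \<Rightarrow>\<^sub>0 'k)"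
  where "phi_Grav n = linear_ext (clique_of_diagram n)"

end

theory Submission
  imports Defs
begin

text \<open>
  Everything happens on basis elements. All three spaces are spanned by combinatorial objects, and
  the partial compositions send two basis elements to one basis element, so the operads involved are
  linearisations of operads in sets. A set operad gives an operad on the spans
  (\<open>set_operad.ns_operad_lin_span\<close>), and a bijective morphism of set operads gives an
  isomorphism of operads (\<open>operad_isomorphism_linear_ext\<close>). Three facts about the basis
  elements remain.

  Cliques form a set operad (\<open>set_operad_cliques\<close>). An arc of an iterated composition lies
  inside one of the three glued polygons, or is a line along which two of them are glued, or
  joins vertices that belong to no common polygon; both sides of each associativity axiom give it
  the same label. The product of the magma need not be associative, because in arity at least 2
  the base and the edges of a polygon are different arcs, so that no label is multiplied twice.

  Cliques with the gravity condition are closed under composition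
  (\<open>gravity_condition_clique_comp\<close>). Solid arcs of \<open>p \<circ>\<^sub>i q\<close> are arcs of \<open>p\<close> or arcs of \<open>q\<close>,
  and an arc of \<open>p\<close> never crosses an arc of \<open>q\<close>; hence crossing solid diagonals come both from \<open>p\<close> or
  both from \<open>q\<close>, and the gravity condition there applies. The arc \<open>(x', y)\<close> that has to be
  non-solid cannot be the gluing line: it would be an edge of \<open>p\<close>, which is solid.

  Recording which arcs are labeled is a bijection from gravity diagrams to gravity
  \<open>D\<^sub>0\<close>-cliques, and it commutes with the compositions (\<open>clique_of_diagram_comp\<close>) because
  \<open>0 * 0 = 0\<close> on the gluing line. The axioms of the operad \<open>Grav\<close> are pulled back along it
  (\<open>set_operad.set_operad_pullback\<close>).
\<close>

section \<open>Linearisation of set operads\<close>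

lemma lin_span_induct [consumes 1, case_names zero add scale basis, induct set: lin_span]:
  assumes "v \<in> lin_span B" and "P 0"
    and "\<And>v w. v \<in> lin_span B \<Longrightarrow> w \<in> lin_span B \<Longrightarrow> P v \<Longrightarrow> P w \<Longrightarrow> P (v + w)"
    and "\<And>a v. v \<in> lin_span B \<Longrightarrow> P v \<Longrightarrow> P (fscale a v)"
    and "\<And>b. b \<in> B \<Longrightarrow> P (basis_vec b)"
  shows "P v"
proof -
  have "v \<in> {v \<in> lin_span B. P v}"
  proof (rule free.span_induct[of v "basis_vec ` B"])
    show "v \<in> free.span (basis_vec ` B)"
      using assms(1) by (simp add: lin_span_def)
    show "free.subspace {v. v \<in> {v \<in> lin_span B. P v}}"
      using assms(2-4) unfolding lin_span_def
      by (auto simp: free.subspace_def free.span_zero free.span_add free.span_scale)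
    show "\<And>w. w \<in> basis_vec ` B \<Longrightarrow> w \<in> {v \<in> lin_span B. P v}"
      using assms(5) by (auto simp: lin_span_def free.span_base)
  qed
  then show ?thesis by simp
qed

lemma subspace_lin_span: "free.subspace (lin_span B)"
  by (simp add: lin_span_def)

lemma lin_span_mono: "B \<subseteq> B' \<Longrightarrow> lin_span B \<subseteq> lin_span B'"
  unfolding lin_span_def by (intro free.span_mono image_mono)

lemma basis_vec_in_lin_span: "b \<in> B \<Longrightarrow> basis_vec b \<in> lin_span B"
  by (simp add: lin_span_def free.span_base)

lemma linear_ext_superset:
  assumes "finite A" "Poly_Mapping.keys v \<subseteq> A"
  shows "linear_ext g v = (\<Sum>b\<in>A. fscale (Poly_Mapping.lookup v b) (basis_vec (g b)))"
  unfolding linear_ext_def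
  by (rule sum.mono_neutral_left) (use assms in \<open>auto simp: in_keys_iff\<close>)

lemma linear_ext_add: "linear_ext g (v + w) = linear_ext g v + linear_ext g w"
proof -
  let ?A = "Poly_Mapping.keys v \<union> Poly_Mapping.keys w"
  have "Poly_Mapping.keys (v + w) \<subseteq> ?A"
    by (rule Poly_Mapping.keys_add)
  then show ?thesis
    by (simp add: linear_ext_superset[of ?A] lookup_add free.scale_left_distrib sum.distrib)
qed

lemma linear_ext_fscale: "linear_ext g (fscale a v) = fscale a (linear_ext g v)"
proof -
  have "Poly_Mapping.keys (fscale a v) \<subseteq> Poly_Mapping.keys v"
    by (auto simp: in_keys_iff)
  then show ?thesis
    by (simp add: linear_ext_superset[of "Poly_Mapping.keys v"] free.scale_sum_right)
qed

lemma linear_ext_zero [simp]: "linear_ext g 0 = 0"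
  by (simp add: linear_ext_def)

lemma linear_ext_basis_vec [simp]:
  "linear_ext g (basis_vec b :: 'b \<Rightarrow>\<^sub>0 'k::field) = basis_vec (g b)"
  by (simp add: linear_ext_def basis_vec_def)

lemma bilinear_ext_eq:
  "bilinear_ext g v w
    = (\<Sum>a\<in>Poly_Mapping.keys v. fscale (Poly_Mapping.lookup v a) (linear_ext (g a) w))"
  by (simp add: bilinear_ext_def linear_ext_def free.scale_sum_right)

lemma bilinear_ext_flip: "bilinear_ext g v w = bilinear_ext (\<lambda>b a. g a b) w v"
  unfolding bilinear_ext_def by (subst sum.swap) (simp add: mult.commute)

lemma bilinear_ext_add_right: "bilinear_ext g v (w + w') = bilinear_ext g v w + bilinear_ext g v w'"
  by (simp add: bilinear_ext_eq linear_ext_add free.scale_right_distrib sum.distrib)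

lemma bilinear_ext_fscale_right: "bilinear_ext g v (fscale a w) = fscale a (bilinear_ext g v w)"
  by (simp add: bilinear_ext_eq linear_ext_fscale free.scale_sum_right mult.commute)

lemma bilinear_ext_add_left: "bilinear_ext g (v + v') w = bilinear_ext g v w + bilinear_ext g v' w"
  unfolding bilinear_ext_flip[of g _ w] by (rule bilinear_ext_add_right)

lemma bilinear_ext_fscale_left: "bilinear_ext g (fscale a v) w = fscale a (bilinear_ext g v w)"
  unfolding bilinear_ext_flip[of g _ w] by (rule bilinear_ext_fscale_right)

lemma bilinear_ext_zero [simp]: "bilinear_ext g 0 w = 0" "bilinear_ext g v 0 = 0"
  by (simp_all add: bilinear_ext_def)

lemma bilinear_ext_basis_vec [simp]:
  "bilinear_ext g (basis_vec a) (basis_vec b :: 'b \<Rightarrow>\<^sub>0 'k::field) = basis_vec (g a b)"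
  by (simp add: bilinear_ext_def basis_vec_def)

lemmas bilinear_ext_linear =
  bilinear_ext_add_left bilinear_ext_add_right bilinear_ext_fscale_left bilinear_ext_fscale_right

text \<open>
  A nonsymmetric operad in sets, with the same indexing by arities as \<open>ns_operad\<close>: the sets \<open>B n\<close>
  may overlap, so that the composition \<open>cmp n m i\<close> carries the arities of its arguments.
\<close>

locale set_operad =
  fixes B :: "nat \<Rightarrow> 'b set" and u :: 'b
    and cmp :: "nat \<Rightarrow> nat \<Rightarrow> nat \<Rightarrow> 'b \<Rightarrow> 'b \<Rightarrow> 'b"
  assumes unit: "u \<in> B 1"
    and closed: "\<lbrakk>n \<ge> 1; m \<ge> 1; i \<in> {1..n}; x \<in> B n; y \<in> B m\<rbrakk> \<Longrightarrow> cmp n m i x y \<in> B (n + m - 1)"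
    and unit_left: "\<lbrakk>n \<ge> 1; x \<in> B n\<rbrakk> \<Longrightarrow> cmp 1 n 1 u x = x"
    and unit_right: "\<lbrakk>n \<ge> 1; i \<in> {1..n}; x \<in> B n\<rbrakk> \<Longrightarrow> cmp n 1 i x u = x"
    and sequential:
      "\<lbrakk>n \<ge> 1; m \<ge> 1; k \<ge> 1; i \<in> {1..n}; j \<in> {1..m}; x \<in> B n; y \<in> B m; z \<in> B k\<rbrakk>
        \<Longrightarrow> cmp (n + m - 1) k (i + j - 1) (cmp n m i x y) z
          = cmp n (m + k - 1) i x (cmp m k j y z)"
    and parallel:
      "\<lbrakk>n \<ge> 1; m \<ge> 1; k \<ge> 1; i \<in> {1..n}; j \<in> {1..n}; i < j; x \<in> B n; y \<in> B m; z \<in> B k\<rbrakk>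
        \<Longrightarrow> cmp (n + m - 1) k (j + m - 1) (cmp n m i x y) z
          = cmp (n + k - 1) m i (cmp n k j x z) y"
begin

lemma ns_operad_lin_span:
  "ns_operad (fscale :: 'k::field \<Rightarrow> ('b \<Rightarrow>\<^sub>0 'k) \<Rightarrow> _)
    (\<lambda>n. lin_span (B n)) (basis_vec u) (\<lambda>n m i. bilinear_ext (cmp n m i))"
proof (intro ns_operad.intro free.vector_space_axioms ns_operad_axioms.intro)
  fix n m k i j :: nat and x x' y y' z :: "'b \<Rightarrow>\<^sub>0 'k" and a :: 'k
  show "free.subspace (lin_span (B n) :: ('b \<Rightarrow>\<^sub>0 'k) set)"
    by (rule subspace_lin_span)
  show "basis_vec u \<in> (lin_span (B 1) :: ('b \<Rightarrow>\<^sub>0 'k) set)"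
    by (simp add: basis_vec_in_lin_span unit del: One_nat_def)
  assume n: "n \<ge> 1"
  show "bilinear_ext (cmp 1 n 1) (basis_vec u) x = x" if "x \<in> lin_span (B n)"
    using that by induction (use n unit_left in \<open>simp_all add: bilinear_ext_linear\<close>)
  show "bilinear_ext (cmp n 1 i) x (basis_vec u) = x" if "i \<in> {1..n}" "x \<in> lin_span (B n)"
    using that(2) by induction (use n that(1) unit_right in \<open>simp_all add: bilinear_ext_linear\<close>)
  assume m: "m \<ge> 1"
  show "bilinear_ext (cmp n m i) x y \<in> lin_span (B (n + m - 1))"
    if i: "i \<in> {1..n}" and x: "x \<in> lin_span (B n)" and y: "y \<in> lin_span (B m)"
    using x
  proof induction
    case (basis b)
    show ?case using y
      by induction (use n m i basis closed in
        \<open>simp_all add: bilinear_ext_linear basis_vec_in_lin_span subspace_lin_span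
          free.subspace_0 free.subspace_add free.subspace_scale\<close>)
  qed (simp_all add: bilinear_ext_linear subspace_lin_span free.subspace_0 free.subspace_add
      free.subspace_scale)
  show "bilinear_ext (cmp (n + m - 1) k (i + j - 1)) (bilinear_ext (cmp n m i) x y) z
      = bilinear_ext (cmp n (m + k - 1) i) x (bilinear_ext (cmp m k j) y z)"
    if k: "k \<ge> 1" and i: "i \<in> {1..n}" and j: "j \<in> {1..m}"
      and x: "x \<in> lin_span (B n)" and y: "y \<in> lin_span (B m)" and z: "z \<in> lin_span (B k)"
    using x
  proof induction
    case b: (basis b)
    show ?case using y
    proof induction
      case c: (basis c)
      show ?case using z
        by induction (simp_all add: bilinear_ext_linear sequential[OF n m k i j b c] del: One_nat_def)
    qed (simp_all add: bilinear_ext_linear)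
  qed (simp_all add: bilinear_ext_linear)
  show "bilinear_ext (cmp (n + m - 1) k (j + m - 1)) (bilinear_ext (cmp n m i) x y) z
      = bilinear_ext (cmp (n + k - 1) m i) (bilinear_ext (cmp n k j) x z) y"
    if k: "k \<ge> 1" and i: "i \<in> {1..n}" and j: "j \<in> {1..n}" and ij: "i < j"
      and x: "x \<in> lin_span (B n)" and y: "y \<in> lin_span (B m)" and z: "z \<in> lin_span (B k)"
    using x
  proof induction
    case b: (basis b)
    show ?case using y
    proof induction
      case c: (basis c)
      show ?case using z
        by induction (simp_all add: bilinear_ext_linear parallel[OF n m k i j ij b c] del: One_nat_def)
    qed (simp_all add: bilinear_ext_linear)
  qed (simp_all add: bilinear_ext_linear)
qed (simp_all add: bilinear_ext_linear)

lemma set_operad_subset: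
  assumes "\<And>n. n \<ge> 1 \<Longrightarrow> B' n \<subseteq> B n" and "u \<in> B' 1"
    and "\<And>n m i x y. \<lbrakk>n \<ge> 1; m \<ge> 1; i \<in> {1..n}; x \<in> B' n; y \<in> B' m\<rbrakk>
      \<Longrightarrow> cmp n m i x y \<in> B' (n + m - 1)"
  shows "set_operad B' u cmp"
proof
qed (use assms in \<open>blast intro: unit_left unit_right sequential parallel\<close>)+

text \<open>
  The axioms hold for \<open>B'\<close> because they hold after applying the injective maps \<open>f n\<close>.
\<close>

lemma set_operad_pullback:
  assumes f: "\<And>n. n \<ge> 1 \<Longrightarrow> bij_betw (f n) (B' n) (B n)"
    and u: "u' \<in> B' 1" "f 1 u' = u"
    and closed': "\<And>n m i x y. \<lbrakk>n \<ge> 1; m \<ge> 1; i \<in> {1..n}; x \<in> B' n; y \<in> B' m\<rbrakk>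
      \<Longrightarrow> cmp' n m i x y \<in> B' (n + m - 1)"
    and f_comp: "\<And>n m i x y. \<lbrakk>n \<ge> 1; m \<ge> 1; i \<in> {1..n}; x \<in> B' n; y \<in> B' m\<rbrakk>
      \<Longrightarrow> f (n + m - 1) (cmp' n m i x y) = cmp n m i (f n x) (f m y)"
  shows "set_operad B' u' cmp'"
proof
  have inj: "x = y" if "f n x = f n y" "n \<ge> 1" "x \<in> B' n" "y \<in> B' n" for n x y
    using f that by (meson bij_betw_imp_inj_on inj_onD)
  have B: "f n x \<in> B n" if "n \<ge> 1" "x \<in> B' n" for n x
    using f that by (meson bij_betwE)
  show "u' \<in> B' 1" by fact
  fix n m k i j :: nat and x y z
  assume n: "n \<ge> 1"
  show "cmp' 1 n 1 u' x = x" if x: "x \<in> B' n"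
    using f_comp[of 1 n 1 u' x] closed'[of 1 n 1 u' x] u n x B unit_left inj[of n]
    by simp
  show "cmp' n 1 i x u' = x" if "i \<in> {1..n}" "x \<in> B' n"
    using f_comp[of n 1 i x u'] closed'[of n 1 i x u'] u n that B unit_right inj[of n]
    by simp
  assume m: "m \<ge> 1"
  show "cmp' n m i x y \<in> B' (n + m - 1)" if "i \<in> {1..n}" "x \<in> B' n" "y \<in> B' m"
    using closed' n m that by blast
  assume k: "k \<ge> 1" and i: "i \<in> {1..n}" and x: "x \<in> B' n" and y: "y \<in> B' m" and z: "z \<in> B' k"
  have nmk: "n + m - 1 \<ge> 1" "m + k - 1 \<ge> 1" "n + k - 1 \<ge> 1"
    "n + m - 1 + k - 1 = n + m + k - 2" "n + (m + k - 1) - 1 = n + m + k - 2"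
    "n + k - 1 + m - 1 = n + m + k - 2" "n + m + k - 2 \<ge> 1"
    using n m k by auto
  show "cmp' (n + m - 1) k (i + j - 1) (cmp' n m i x y) z
          = cmp' n (m + k - 1) i x (cmp' m k j y z)" if j: "j \<in> {1..m}"
  proof (rule inj[of "n + m + k - 2"])
    have ij: "i + j - 1 \<in> {1..n + m - 1}" using i j by auto
    note xy = closed'[OF n m i x y] and yz = closed'[OF m k j y z]
    show "cmp' (n + m - 1) k (i + j - 1) (cmp' n m i x y) z \<in> B' (n + m + k - 2)"
      using closed'[OF nmk(1) k ij xy z] nmk by simp
    show "cmp' n (m + k - 1) i x (cmp' m k j y z) \<in> B' (n + m + k - 2)"
      using closed'[OF n nmk(2) i x yz] nmk by simp
    show "f (n + m + k - 2) (cmp' (n + m - 1) k (i + j - 1) (cmp' n m i x y) z)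
        = f (n + m + k - 2) (cmp' n (m + k - 1) i x (cmp' m k j y z))"
      using f_comp[OF nmk(1) k ij xy z] f_comp[OF n nmk(2) i x yz]
        f_comp[OF n m i x y] f_comp[OF m k j y z]
        sequential[OF n m k i j B[OF n x] B[OF m y] B[OF k z]] nmk by metis
  qed (use nmk in simp)
  show "cmp' (n + m - 1) k (j + m - 1) (cmp' n m i x y) z
          = cmp' (n + k - 1) m i (cmp' n k j x z) y" if j: "j \<in> {1..n}" and "i < j"
  proof (rule inj[of "n + m + k - 2"])
    have ij: "j + m - 1 \<in> {1..n + m - 1}" "i \<in> {1..n + k - 1}" using i j m k by auto
    note xy = closed'[OF n m i x y] and xz = closed'[OF n k j x z]
    show "cmp' (n + m - 1) k (j + m - 1) (cmp' n m i x y) z \<in> B' (n + m + k - 2)"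
      using closed'[OF nmk(1) k ij(1) xy z] nmk by simp
    show "cmp' (n + k - 1) m i (cmp' n k j x z) y \<in> B' (n + m + k - 2)"
      using closed'[OF nmk(3) m ij(2) xz y] nmk by simp
    show "f (n + m + k - 2) (cmp' (n + m - 1) k (j + m - 1) (cmp' n m i x y) z)
        = f (n + m + k - 2) (cmp' (n + k - 1) m i (cmp' n k j x z) y)"
      using f_comp[OF nmk(1) k ij(1) xy z] f_comp[OF nmk(3) m ij(2) xz y]
        f_comp[OF n m i x y] f_comp[OF n k j x z]
        parallel[OF n m k i j \<open>i < j\<close> B[OF n x] B[OF m y] B[OF k z]] nmk by metis
  qed (use nmk in simp)
qed

end

lemma bij_betw_linear_ext:
  fixes g :: "'b \<Rightarrow> 'c"
  assumes "bij_betw g B C"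
  shows "bij_betw (linear_ext g) (lin_span B) (lin_span C :: ('c \<Rightarrow>\<^sub>0 'k::field) set)"
proof (rule bij_betw_byWitness[where f' = "linear_ext (inv_into B g)"])
  have closed: "linear_ext h v \<in> (lin_span E :: ('e \<Rightarrow>\<^sub>0 'k) set)"
    if "v \<in> lin_span D" "\<And>b. b \<in> D \<Longrightarrow> h b \<in> E" for h :: "'d \<Rightarrow> 'e" and D E v
    using that(1) by induction
      (simp_all add: that(2) linear_ext_add linear_ext_fscale basis_vec_in_lin_span
        subspace_lin_span free.subspace_0 free.subspace_add free.subspace_scale)
  show "linear_ext g ` lin_span B \<subseteq> (lin_span C :: ('c \<Rightarrow>\<^sub>0 'k) set)"
    using assms by (auto intro!: closed dest: bij_betwE)
  show "linear_ext (inv_into B g) ` lin_span C \<subseteq> (lin_span B :: ('b \<Rightarrow>\<^sub>0 'k) set)"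
    using assms[THEN bij_betw_inv_into] by (auto intro!: closed dest: bij_betwE)
  show "\<forall>v \<in> lin_span B. linear_ext (inv_into B g) (linear_ext g v) = (v :: _ \<Rightarrow>\<^sub>0 'k)"
  proof
    fix v :: "'b \<Rightarrow>\<^sub>0 'k" assume "v \<in> lin_span B"
    then show "linear_ext (inv_into B g) (linear_ext g v) = v"
      by induction (simp_all add: linear_ext_add linear_ext_fscale
        bij_betw_inv_into_left[OF assms])
  qed
  show "\<forall>v \<in> lin_span C. linear_ext g (linear_ext (inv_into B g) v) = (v :: _ \<Rightarrow>\<^sub>0 'k)"
  proof
    fix v :: "'c \<Rightarrow>\<^sub>0 'k" assume "v \<in> lin_span C"
    then show "linear_ext g (linear_ext (inv_into B g) v) = v"
      by induction (simp_all add: linear_ext_add linear_ext_fscale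
        bij_betw_inv_into_right[OF assms])
  qed
qed

lemma operad_isomorphism_linear_ext:
  assumes B: "set_operad B u cmp" and C: "set_operad C u' cmp'"
    and f: "\<And>n. n \<ge> 1 \<Longrightarrow> bij_betw (f n) (B n) (C n)"
    and unit: "f 1 u = u'"
    and f_comp: "\<And>n m i x y. \<lbrakk>n \<ge> 1; m \<ge> 1; i \<in> {1..n}; x \<in> B n; y \<in> B m\<rbrakk>
      \<Longrightarrow> f (n + m - 1) (cmp n m i x y) = cmp' n m i (f n x) (f m y)"
  shows "operad_isomorphism
      (fscale :: 'k::field \<Rightarrow> ('b \<Rightarrow>\<^sub>0 'k) \<Rightarrow> _)
      (\<lambda>n. lin_span (B n)) (basis_vec u) (\<lambda>n m i. bilinear_ext (cmp n m i))
      (fscale :: 'k::field \<Rightarrow> ('c \<Rightarrow>\<^sub>0 'k) \<Rightarrow> _)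
      (\<lambda>n. lin_span (C n)) (basis_vec u') (\<lambda>n m i. bilinear_ext (cmp' n m i))
      (\<lambda>n. linear_ext (f n))"
proof (intro operad_isomorphism.intro operad_morphism.intro operad_morphism_axioms.intro
    operad_isomorphism_axioms.intro set_operad.ns_operad_lin_span[OF B]
    set_operad.ns_operad_lin_span[OF C])
  fix n m i :: nat and x y :: "'b \<Rightarrow>\<^sub>0 'k"
  assume n: "n \<ge> 1"
  show "bij_betw (linear_ext (f n)) (lin_span (B n)) (lin_span (C n) :: ('c \<Rightarrow>\<^sub>0 'k) set)"
    by (intro bij_betw_linear_ext f n)
  then show "linear_ext (f n) x \<in> lin_span (C n)" if "x \<in> lin_span (B n)"
    using that by (meson bij_betwE)
  show "linear_ext (f (n + m - 1)) (bilinear_ext (cmp n m i) x y)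
      = bilinear_ext (cmp' n m i) (linear_ext (f n) x) (linear_ext (f m) y)"
    if m: "m \<ge> 1" and i: "i \<in> {1..n}" and x: "x \<in> lin_span (B n)" and y: "y \<in> lin_span (B m)"
    using x
  proof induction
    case b: (basis b)
    show ?case using y
      by induction (simp_all add: linear_ext_add linear_ext_fscale bilinear_ext_linear
          f_comp[OF n m i b] del: One_nat_def)
  qed (simp_all add: linear_ext_add linear_ext_fscale bilinear_ext_linear)
qed (use unit in \<open>simp_all add: linear_ext_add linear_ext_fscale\<close>)

section \<open>The set operad of cliques\<close>

text \<open>
  The label of an arc in each of the regions cut out by the gluing line \<open>(i + 1, i + m + 2)\<close>, for the
  composition of \<open>p\<close> at position \<open>i + 1\<close> with \<open>q\<close> of arity \<open>m + 1\<close>. The regions overlap: being different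
  from the gluing line is expressed by one strict inequality at either end, so that all side
  conditions are linear.
\<close>

lemma clique_comp_Suc_apply:
  assumes "1 \<le> x" "x < y" "y \<le> n + m + 1"
  shows "y \<le> i + 1 \<Longrightarrow> clique_comp n (Suc m) (Suc i) p q (x, y) = p (x, y)"
    and "x \<le> i \<Longrightarrow> i + m + 2 \<le> y \<Longrightarrow> clique_comp n (Suc m) (Suc i) p q (x, y) = p (x, y - m)"
    and "x \<le> i + 1 \<Longrightarrow> i + m + 3 \<le> y \<Longrightarrow> clique_comp n (Suc m) (Suc i) p q (x, y) = p (x, y - m)"
    and "i + m + 2 \<le> x \<Longrightarrow> clique_comp n (Suc m) (Suc i) p q (x, y) = p (x - m, y - m)"
    and "i + 2 \<le> x \<Longrightarrow> y \<le> i + m + 2 \<Longrightarrow>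
      clique_comp n (Suc m) (Suc i) p q (x, y) = q (x - i, y - i)"
    and "i + 1 \<le> x \<Longrightarrow> y \<le> i + m + 1 \<Longrightarrow>
      clique_comp n (Suc m) (Suc i) p q (x, y) = q (x - i, y - i)"
    and "x = i + 1 \<Longrightarrow> y = i + m + 2 \<Longrightarrow>
      clique_comp n (Suc m) (Suc i) p q (x, y) = p (i + 1, i + 2) * q (1, m + 2)"
    and "x \<le> i \<Longrightarrow> i + 2 \<le> y \<Longrightarrow> y \<le> i + m + 1 \<Longrightarrow> clique_comp n (Suc m) (Suc i) p q (x, y) = 1"
    and "i + 2 \<le> x \<Longrightarrow> x \<le> i + m + 1 \<Longrightarrow> i + m + 3 \<le> y \<Longrightarrow>
      clique_comp n (Suc m) (Suc i) p q (x, y) = 1"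
  using assms by (auto simp: clique_comp_def arcs_def base_def Suc_diff_le Suc_diff_Suc)

lemma clique_comp_extensional: "clique_comp n m i p q \<in> extensional (arcs (n + m - 1))"
  by (simp add: clique_comp_def)

lemma clique_ext:
  assumes "p \<in> extensional (arcs n)" "q \<in> extensional (arcs n)"
    and "\<And>x y. 1 \<le> x \<Longrightarrow> x < y \<Longrightarrow> y \<le> n + 1 \<Longrightarrow> p (x, y) = q (x, y)"
  shows "p = q"
  by (rule extensionalityI[OF assms(1,2)]) (auto simp: arcs_def assms(3))

text \<open>
  In both associativity laws the ends \<open>a, b, c, d\<close> of the two gluing lines are linearly ordered, and
  the position of \<open>x\<close> and \<open>y\<close> relative to them determines which clause of the composition applies at
  each of the four compositions. Here the line \<open>(b, c)\<close> is nested in \<open>(a, d)\<close>.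
\<close>

lemma clique_comp_sequential:
  assumes "m \<ge> 1" "k \<ge> 1" "i < n" "j \<le> m"
  shows "clique_comp (n + m) (Suc k) (Suc (i + j)) (clique_comp n (Suc m) (Suc i) p q) r
      = clique_comp n (Suc (m + k)) (Suc i) p (clique_comp (Suc m) (Suc k) (Suc j) q r)"
    (is "?lhs = ?rhs")
proof (rule clique_ext)
  show "?lhs \<in> extensional (arcs (n + m + k))" "?rhs \<in> extensional (arcs (n + m + k))"
    using clique_comp_extensional[of "n + m" "Suc k"] clique_comp_extensional[of n "Suc (m + k)"]
    by (simp_all add: add.assoc)
  fix x y assume xy: "1 \<le> x" "x < y" "y \<le> n + m + k + 1"
  define a b c d where "a = Suc i" and "b = Suc (i + j)" and "c = i + j + k + 2"
    and "d = i + m + k + 2"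
  note ends = a_def b_def c_def d_def
  have "a \<le> b" "b < c" "c \<le> d"
    using assms by (simp_all add: ends)
  then consider "y \<le> a"
    | "d \<le> y" "x < a"
    | "d < y" "x \<le> a"
    | "d \<le> x"
    | "x = a" "y = d" "a = b"
    | "x = a" "y = d" "a < b"
    | "a \<le> x" "y \<le> b"
    | "a < x" "x < b" "c \<le> y" "y \<le> d"
    | "a < x" "x \<le> b" "c < y" "y \<le> d"
    | "a \<le> x" "x < b" "c \<le> y" "y < d"
    | "a \<le> x" "x \<le> b" "c < y" "y < d"
    | "c \<le> x" "y \<le> d"
    | "x = b" "y = c" "c = d"
    | "x = b" "y = c" "c < d"
    | "b < x" "y \<le> c"
    | "b \<le> x" "y < c"
    | "a \<le> x" "x < b" "b < y" "y < c"
    | "b < x" "x < c" "c < y" "y \<le> d"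
    | "x < a" "a < y" "y \<le> b"
    | "x < a" "b < y" "y < c"
    | "x < a" "c \<le> y" "y < d"
    | "a < x" "x \<le> b" "d < y"
    | "b < x" "x < c" "d < y"
    | "c \<le> x" "x < d" "d < y"
    using \<open>x < y\<close> by (smt (verit) le_eq_less_or_eq not_less)
  then show "?lhs (x, y) = ?rhs (x, y)"
  proof cases
    case 1
    then show ?thesis using xy assms
      by (simp_all add: ends clique_comp_Suc_apply(1) add.commute)
  next
    case 2
    then show ?thesis using xy assms
      by (simp_all add: ends clique_comp_Suc_apply(2) add.commute)
  next
    case 3
    then show ?thesis using xy assms
      by (simp_all add: ends clique_comp_Suc_apply(3) add.commute)
  next
    case 4
    then show ?thesis using xy assms
      by (simp_all add: ends clique_comp_Suc_apply(4) add.commute)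
  next
    case 5
    then show ?thesis using xy assms
      by (simp_all add: ends clique_comp_Suc_apply(3,7) add.commute)
  next
    case 6
    then show ?thesis using xy assms
      by (simp_all add: ends clique_comp_Suc_apply(2,7) add.commute)
  next
    case 7
    then show ?thesis using xy assms
      by (simp_all add: ends clique_comp_Suc_apply(1,6) add.commute)
  next
    case 8
    then show ?thesis using xy assms
      by (simp_all add: ends clique_comp_Suc_apply(2,5) add.commute)
  next
    case 9
    then show ?thesis using xy assms
      by (simp_all add: ends clique_comp_Suc_apply(3,5) add.commute)
  next
    case 10
    then show ?thesis using xy assms
      by (simp_all add: ends clique_comp_Suc_apply(2,6) add.commute)
  next
    case 11
    then show ?thesis using xy assms
      by (simp_all add: ends clique_comp_Suc_apply(3,6) add.commute)
  next
    case 12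
    then show ?thesis using xy assms
      by (simp_all add: ends clique_comp_Suc_apply(4,5) add.commute)
  next
    case 13
    then show ?thesis using xy assms
      by (simp_all add: ends clique_comp_Suc_apply(5,6,7) add.commute)
  next
    case 14
    then show ?thesis using xy assms
      by (simp_all add: ends clique_comp_Suc_apply(6,7) add.commute)
  next
    case 15
    then show ?thesis using xy assms
      by (simp_all add: ends clique_comp_Suc_apply(5) add.commute)
  next
    case 16
    then show ?thesis using xy assms
      by (simp_all add: ends clique_comp_Suc_apply(6) add.commute)
  next
    case 17
    then show ?thesis using xy assms
      by (simp_all add: ends clique_comp_Suc_apply(6,8) add.commute)
  next
    case 18
    then show ?thesis using xy assms
      by (simp_all add: ends clique_comp_Suc_apply(5,9) add.commute)
  next
    case 19
    then show ?thesis using xy assms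
      by (simp_all add: ends clique_comp_Suc_apply(1,8) add.commute)
  next
    case 20
    then show ?thesis using xy assms
      by (simp_all add: ends clique_comp_Suc_apply(8) add.commute)
  next
    case 21
    then show ?thesis using xy assms
      by (simp_all add: ends clique_comp_Suc_apply(2,8) add.commute)
  next
    case 22
    then show ?thesis using xy assms
      by (simp_all add: ends clique_comp_Suc_apply(3,9) add.commute)
  next
    case 23
    then show ?thesis using xy assms
      by (simp_all add: ends clique_comp_Suc_apply(9) add.commute)
  next
    case 24
    then show ?thesis using xy assms
      by (simp_all add: ends clique_comp_Suc_apply(4,9) add.commute)
  qed
qed

text \<open>
  Here the lines \<open>(a, b)\<close> and \<open>(c, d)\<close> lie side by side.
\<close>

lemma clique_comp_parallel:
  assumes "m \<ge> 1" "k \<ge> 1" "i < j" "j < n"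
  shows "clique_comp (n + m) (Suc k) (Suc (j + m)) (clique_comp n (Suc m) (Suc i) p q) r
      = clique_comp (n + k) (Suc m) (Suc i) (clique_comp n (Suc k) (Suc j) p r) q"
    (is "?lhs = ?rhs")
proof (rule clique_ext)
  show "?lhs \<in> extensional (arcs (n + m + k))" "?rhs \<in> extensional (arcs (n + m + k))"
    using clique_comp_extensional[of "n + m" "Suc k"] clique_comp_extensional[of "n + k" "Suc m"]
    by (simp_all add: ac_simps)
  fix x y assume xy: "1 \<le> x" "x < y" "y \<le> n + m + k + 1"
  define a b c d where "a = Suc i" and "b = i + m + 2" and "c = j + m + 1"
    and "d = j + m + k + 2"
  note ends = a_def b_def c_def d_def
  have "a < b" "b \<le> c" "c < d"
    using assms by (simp_all add: ends)
  then consider "y \<le> a"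
    | "x < a" "b \<le> y" "y \<le> c"
    | "x \<le> a" "b < y" "y \<le> c"
    | "b \<le> x" "y \<le> c"
    | "x \<le> a" "d \<le> y"
    | "b \<le> x" "x < c" "d \<le> y"
    | "b \<le> x" "x \<le> c" "d < y"
    | "d \<le> x"
    | "a < x" "y \<le> b"
    | "a \<le> x" "y < b"
    | "x = a" "y = b"
    | "c < x" "y \<le> d"
    | "c \<le> x" "y < d"
    | "x = c" "y = d"
    | "x < a" "a < y" "y < b"
    | "a < x" "x < b" "b < y" "y \<le> c"
    | "a < x" "x < b" "c < y" "y < d"
    | "a < x" "x < b" "d \<le> y"
    | "x \<le> a" "c < y" "y < d"
    | "b \<le> x" "x < c" "c < y" "y < d"
    | "c < x" "x < d" "d < y"
    using \<open>x < y\<close> by (smt (verit) le_eq_less_or_eq not_less)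
  then show "?lhs (x, y) = ?rhs (x, y)"
  proof cases
    case 1
    then show ?thesis using xy assms
      by (simp_all add: ends clique_comp_Suc_apply(1) add.commute)
  next
    case 2
    then show ?thesis using xy assms
      by (simp_all add: ends clique_comp_Suc_apply(1,2) add.commute)
  next
    case 3
    then show ?thesis using xy assms
      by (simp_all add: ends clique_comp_Suc_apply(1,3) add.commute)
  next
    case 4
    then show ?thesis using xy assms
      by (simp_all add: ends clique_comp_Suc_apply(1,4) add.commute)
  next
    case 5
    then show ?thesis using xy assms
      by (simp_all add: ends clique_comp_Suc_apply(2,3) add.commute)
  next
    case 6
    then show ?thesis using xy assms
      by (simp_all add: ends clique_comp_Suc_apply(2,4) add.commute)
  next
    case 7
    then show ?thesis using xy assms
      by (simp_all add: ends clique_comp_Suc_apply(3,4) add.commute)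
  next
    case 8
    then show ?thesis using xy assms
      by (simp_all add: ends clique_comp_Suc_apply(4) add.commute)
  next
    case 9
    then show ?thesis using xy assms
      by (simp_all add: ends clique_comp_Suc_apply(1,5) add.commute)
  next
    case 10
    then show ?thesis using xy assms
      by (simp_all add: ends clique_comp_Suc_apply(1,6) add.commute)
  next
    case 11
    then show ?thesis using xy assms
      by (simp_all add: ends clique_comp_Suc_apply(1,7) add.commute)
  next
    case 12
    then show ?thesis using xy assms
      by (simp_all add: ends clique_comp_Suc_apply(4,5) add.commute)
  next
    case 13
    then show ?thesis using xy assms
      by (simp_all add: ends clique_comp_Suc_apply(4,6) add.commute)
  next
    case 14
    then show ?thesis using xy assms
      by (simp_all add: ends clique_comp_Suc_apply(4,7) add.commute)
  next
    case 15
    then show ?thesis using xy assms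
      by (simp_all add: ends clique_comp_Suc_apply(1,8) add.commute)
  next
    case 16
    then show ?thesis using xy assms
      by (simp_all add: ends clique_comp_Suc_apply(1,9) add.commute)
  next
    case 17
    then show ?thesis using xy assms
      by (simp_all add: ends clique_comp_Suc_apply(8,9) add.commute)
  next
    case 18
    then show ?thesis using xy assms
      by (simp_all add: ends clique_comp_Suc_apply(2,9) add.commute)
  next
    case 19
    then show ?thesis using xy assms
      by (simp_all add: ends clique_comp_Suc_apply(3,8) add.commute)
  next
    case 20
    then show ?thesis using xy assms
      by (simp_all add: ends clique_comp_Suc_apply(4,8) add.commute)
  next
    case 21
    then show ?thesis using xy assms
      by (simp_all add: ends clique_comp_Suc_apply(4,9) add.commute)
  qed
qed

lemma cliques_extensional: "p \<in> cliques n \<Longrightarrow> p \<in> extensional (arcs n)"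
  by (auto simp: cliques_def unit_clique_def PiE_def split: if_splits)

lemma unit_in_cliques: "unit_clique \<in> cliques 1"
  by (simp add: cliques_def)

lemma clique_comp_unit_left:
  assumes "p \<in> cliques n"
  shows "clique_comp 1 n 1 unit_clique p = p"
proof (rule clique_ext)
  show "clique_comp 1 n 1 unit_clique p \<in> extensional (arcs n)"
    using clique_comp_extensional[of 1 n] by simp
  show "p \<in> extensional (arcs n)"
    using assms by (rule cliques_extensional)
qed (auto simp: clique_comp_def unit_clique_def arcs_def base_def
      magma_unit_left)

lemma clique_comp_unit_right:
  assumes "p \<in> cliques n"
  shows "clique_comp n 1 i p unit_clique = p"
proof (rule clique_ext)
  show "clique_comp n 1 i p unit_clique \<in> extensional (arcs n)"
    using clique_comp_extensional[of n 1] by simp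
  show "p \<in> extensional (arcs n)"
    using assms by (rule cliques_extensional)
qed (auto simp: clique_comp_def unit_clique_def arcs_def base_def
      magma_unit_right)

lemma clique_comp_closed:
  assumes "n \<ge> 1" "m \<ge> 1" "i \<in> {1..n}" "p \<in> cliques n" "q \<in> cliques m"
  shows "clique_comp n m i p q \<in> cliques (n + m - 1)"
proof (cases "n + m - 1 = 1")
  case True
  then have "n = 1" "m = 1" "i = 1"
    using assms by auto
  then show ?thesis
    using assms clique_comp_unit_right[of p 1] by (simp add: cliques_def)
next
  case False
  then show ?thesis
    using clique_comp_extensional[of n m i p q] by (simp add: cliques_def PiE_def)
qed

lemma set_operad_cliques:
  "set_operad (cliques :: nat \<Rightarrow> 'm::unitary_magma clique set) unit_clique clique_comp"
proof
  fix n m k i j :: nat and p q r :: "'m clique"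
  show "(unit_clique :: 'm clique) \<in> cliques 1"
    by (rule unit_in_cliques)
  show "clique_comp 1 n 1 unit_clique p = p" if "p \<in> cliques n"
    using that by (rule clique_comp_unit_left)
  show "clique_comp n 1 i p unit_clique = p" if "p \<in> cliques n"
    using that by (rule clique_comp_unit_right)
  assume n: "n \<ge> 1" and m: "m \<ge> 1" and i: "i \<in> {1..n}"
    and p: "p \<in> cliques n" and q: "q \<in> cliques m"
  show "clique_comp n m i p q \<in> cliques (n + m - 1)"
    by (rule clique_comp_closed) fact+
  assume k: "k \<ge> 1" and r: "r \<in> cliques k"
  show "clique_comp (n + m - 1) k (i + j - 1) (clique_comp n m i p q) r
      = clique_comp n (m + k - 1) i p (clique_comp m k j q r)" if j: "j \<in> {1..m}"
  proof -
    (* The two laws above need arities at least 2; the unit is the only clique of arity 1. *)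
    consider "m = 1" | "k = 1" | m' k' i' j' where "m = Suc m'" "k = Suc k'" "i = Suc i'" "j = Suc j'"
      "m' \<ge> 1" "k' \<ge> 1" "i' < n" "j' \<le> m'"
      using m k i j by (cases m; cases k; cases i; cases j) force+
    then show ?thesis
    proof cases
      case 1
      then have "j = 1" "q = unit_clique" using j q by (auto simp: cliques_def)
      then show ?thesis
        using 1 i clique_comp_unit_left[OF r] clique_comp_unit_right[OF p, of i] by simp
    next
      case 2
      then have "r = unit_clique" using r by (simp add: cliques_def)
      then show ?thesis
        using 2 clique_comp_unit_right[OF q]
          clique_comp_unit_right[OF clique_comp_closed[OF n m i p q]] by simp
    next
      case 3
      then show ?thesis using clique_comp_sequential[of m' k' i' n j' p q r] by simp
    qed
  qed
  show "clique_comp (n + m - 1) k (j + m - 1) (clique_comp n m i p q) r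
      = clique_comp (n + k - 1) m i (clique_comp n k j p r) q" if j: "j \<in> {1..n}" and "i < j"
  proof -
    consider "m = 1" | "k = 1" | m' k' i' j' where "m = Suc m'" "k = Suc k'" "i = Suc i'" "j = Suc j'"
      "m' \<ge> 1" "k' \<ge> 1" "i' < j'" "j' < n"
      using m k i j \<open>i < j\<close> by (cases m; cases k; cases i; cases j) force+
    then show ?thesis
    proof cases
      case 1
      then have "q = unit_clique" using q by (simp add: cliques_def)
      then show ?thesis
        using 1 clique_comp_unit_right[OF p]
          clique_comp_unit_right[OF clique_comp_closed[OF n k j p r]] by simp
    next
      case 2
      then have "r = unit_clique" using r by (simp add: cliques_def)
      then show ?thesis
        using 2 clique_comp_unit_right[OF p]
          clique_comp_unit_right[OF clique_comp_closed[OF n m i p q]] by simp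
    next
      case 3
      then show ?thesis using clique_comp_parallel[of m' k' i' j' n p q r] by simp
    qed
  qed
qed

section \<open>Cliques with the gravity condition\<close>

text \<open>
  Crossing arcs are automatically diagonals, so diagonals need not be mentioned.
\<close>

lemma gravity_condition_iff:
  assumes "n \<ge> 2"
  shows "gravity_condition n p \<longleftrightarrow>
    (\<forall>x \<in> {1..n}. p (x, x + 1) \<noteq> 1) \<and> p (1, n + 1) \<noteq> 1 \<and>
    (\<forall>x x' y y'. 1 \<le> x \<longrightarrow> x < x' \<longrightarrow> x' < y \<longrightarrow> y < y' \<longrightarrow> y' \<le> n + 1 \<longrightarrow>
      p (x, y) \<noteq> 1 \<longrightarrow> p (x', y') \<noteq> 1 \<longrightarrow> p (x', y) = 1)"
proof -
  have diag: "(x, y) \<in> diagonals n \<and> (x', y') \<in> diagonals n \<and> crossing (x, y) (x', y') \<and> x < x' \<longleftrightarrow>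
      1 \<le> x \<and> x < x' \<and> x' < y \<and> y < y' \<and> y' \<le> n + 1" for x y x' y'
    by (auto simp: diagonals_def arcs_def edges_def base_def)
  have "edges n \<union> {base n} = (\<lambda>x. (x, x + 1)) ` {1..n} \<union> {base n}"
    by (auto simp: edges_def)
  then have edges: "(\<forall>a \<in> edges n \<union> {base n}. solid p a) \<longleftrightarrow>
      (\<forall>x \<in> {1..n}. p (x, x + 1) \<noteq> 1) \<and> p (1, n + 1) \<noteq> 1"
    by (simp add: solid_def base_def conj_commute)
  have "(\<forall>x y x' y'. (x, y) \<in> diagonals n \<and> (x', y') \<in> diagonals n \<and> crossing (x, y) (x', y')
        \<and> x < x' \<and> p (x, y) \<noteq> 1 \<and> p (x', y') \<noteq> 1 \<longrightarrow> p (x', y) = 1) \<longleftrightarrow>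
      (\<forall>x x' y y'. 1 \<le> x \<longrightarrow> x < x' \<longrightarrow> x' < y \<longrightarrow> y < y' \<longrightarrow> y' \<le> n + 1 \<longrightarrow>
        p (x, y) \<noteq> 1 \<longrightarrow> p (x', y') \<noteq> 1 \<longrightarrow> p (x', y) = 1)"
    using diag by blast
  then show ?thesis
    using assms edges by (simp add: gravity_condition_def)
qed

text \<open>
  The hypothesis on the magma makes the label of the gluing line solid. It holds in \<open>D\<^sub>0\<close>.
\<close>

lemma gravity_condition_clique_comp:
  fixes p q :: "'m::unitary_magma clique"
  assumes mult: "\<And>a b :: 'm. a \<noteq> 1 \<Longrightarrow> b \<noteq> 1 \<Longrightarrow> a * b \<noteq> 1"
    and n: "n \<ge> 2" and m: "m \<ge> 2" and i: "i \<in> {1..n}"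
    and p: "gravity_condition n p" and q: "gravity_condition m q"
  shows "gravity_condition (n + m - 1) (clique_comp n m i p q)"
proof -
  obtain l h where l: "m = Suc l" and h: "i = Suc h" and lh: "l \<ge> 1" "h < n"
    using m i by (cases m; cases i) auto
  define f where "f = clique_comp n m i p q"
  note val = clique_comp_Suc_apply[of _ _ n l h p q, folded l h, folded f_def]
  note p' = p[unfolded gravity_condition_iff[OF n]]
  note q' = q[unfolded gravity_condition_iff[OF m]]
  have p_edge: "p (x, Suc x) \<noteq> 1" if "1 \<le> x" "x \<le> n" for x
    using p' that by auto
  have q_edge: "q (x, Suc x) \<noteq> 1" if "1 \<le> x" "x \<le> m" for x
    using q' that by auto
  have "f (x, x + 1) \<noteq> 1" if x: "x \<in> {1..n + m - 1}" for x
  proof -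
    consider "x < i" | "i \<le> x" "x < i + m" | "i + m \<le> x" by linarith
    then show ?thesis
    proof cases
      case 1
      then show ?thesis using val(1)[of x "x + 1"] x p_edge[of x] i h by auto
    next
      case 2
      have "f (x, x + 1) = q (x - h, x + 1 - h)"
        using 2 val(5,6)[of x "x + 1"] x h l lh by (cases "x = i") auto
      then show ?thesis using q_edge[of "x - h"] 2 h by (simp add: Suc_diff_le)
    next
      case 3
      then show ?thesis using val(4)[of x "x + 1"] x h l p_edge[of "x - l"] by (simp add: Suc_diff_le)
    qed
  qed
  moreover have "f (1, n + m - 1 + 1) \<noteq> 1"
  proof -
    have "f (1, n + l + 1) = p (1, n + 1)"
      using val(2,3)[of 1 "n + l + 1"] n h lh by (cases "h = 0") auto
    then show ?thesis using p' l by simp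
  qed
  moreover have "f (x', y) = 1"
    if ord: "1 \<le> x" "x < x'" "x' < y" "y < y'" "y' \<le> n + m - 1 + 1"
      and s: "f (x, y) \<noteq> 1" "f (x', y') \<noteq> 1" for x x' y y'
  proof -
    have bd: "y' \<le> n + l + 1" using ord l by simp
    (* A solid arc joins two vertices of q, or two vertices of p. *)
    have inner_or_outer: "i \<le> u \<and> v \<le> i + m \<or> (u \<le> i \<or> i + m \<le> u) \<and> (v \<le> i \<or> i + m \<le> v)"
      if "1 \<le> u" "u < v" "v \<le> n + l + 1" "f (u, v) \<noteq> 1" for u v
    proof (rule ccontr)
      assume "\<not> ?thesis"
      then have "u < i \<and> i < v \<and> v < i + m \<or> i < u \<and> u < i + m \<and> i + m < v"
        by auto
      then show False
        using val(8,9)[of u v] that h l by auto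
    qed
    (* An arc of q cannot cross an arc of p. *)
    have "i \<le> x \<and> y' \<le> i + m \<or> (x \<le> i \<or> i + m \<le> x) \<and> (x' \<le> i \<or> i + m \<le> x') \<and>
        (y \<le> i \<or> i + m \<le> y) \<and> (y' \<le> i \<or> i + m \<le> y')"
      using inner_or_outer[of x y] inner_or_outer[of x' y'] ord s bd by linarith
    then show ?thesis
    proof (elim disjE)
      assume inner: "i \<le> x \<and> y' \<le> i + m"
      have "f (x, y) = q (x - h, y - h)" "f (x', y') = q (x' - h, y' - h)"
        "f (x', y) = q (x' - h, y - h)"
        using val(6)[of x y] val(5)[of x' y'] val(5)[of x' y] ord inner h l bd by auto
      moreover have "1 \<le> x - h" "x - h < x' - h" "x' - h < y - h" "y - h < y' - h" "y' - h \<le> m + 1"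
        using ord inner h by auto
      ultimately show ?thesis
        using q' s by metis
    next
      (* t sends the vertices of the composition that come from p back to their numbers in p. *)
      define t where "t z = (if z \<le> i then z else z - l)" for z
      assume outer: "(x \<le> i \<or> i + m \<le> x) \<and> (x' \<le> i \<or> i + m \<le> x') \<and>
        (y \<le> i \<or> i + m \<le> y) \<and> (y' \<le> i \<or> i + m \<le> y')"
      have val_p: "f (u, v) = p (t u, t v)"
        if uv: "1 \<le> u" "u < v" "v \<le> n + l + 1" "u \<le> i \<or> i + m \<le> u" "v \<le> i \<or> i + m \<le> v"
          "u \<noteq> i \<or> v \<noteq> i + m" for u v
      proof -
        consider "v \<le> i" | "u < i" "i + m \<le> v" | "u \<le> i" "i + m < v" | "i + m \<le> u"
          using uv(2,4-6) by (cases "v \<le> i"; cases "i + m \<le> u"; cases "u = i") auto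
        then show ?thesis
        proof cases
          case 1
          then show ?thesis using uv(1-3) val(1)[of u v] h by (simp add: t_def)
        next
          case 2
          then show ?thesis using uv(1-3) val(2)[of u v] h l by (simp add: t_def)
        next
          case 3
          then show ?thesis using uv(1-3) val(3)[of u v] h l by (simp add: t_def)
        next
          case 4
          then show ?thesis using uv(1-3) val(4)[of u v] h l by (simp add: t_def)
        qed
      qed
      have t: "1 \<le> t x" "t x < t x'" "t x' < t y" "t y < t y'" "t y' \<le> n + 1"
        using ord outer l i bd by (auto simp: t_def)
      have "f (x, y) = p (t x, t y)" "f (x', y') = p (t x', t y')"
        using val_p[of x y] val_p[of x' y'] ord outer bd by auto
      then have *: "p (t x', t y) = 1"
        using p' t s by metis
      (* The gluing line is the image of an edge of p, and edges of p are solid. *)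
      have "\<not> (x' = i \<and> y = i + m)"
        using * p_edge[of i] i l by (auto simp: t_def)
      then show ?thesis
        using * val_p[of x' y] ord outer bd by auto
    qed
  qed
  ultimately show ?thesis
    using n m unfolding f_def by (subst gravity_condition_iff) auto
qed

text \<open>
  The basis of \<open>gravity_space n\<close>.
\<close>

definition gravity_cliques :: "nat \<Rightarrow> 'm::unitary_magma clique set"
  where "gravity_cliques n = {p \<in> cliques n. gravity_condition n p}"

lemma clique_comp_gravity_cliques:
  fixes p q :: "'m::unitary_magma clique"
  assumes mult: "\<And>a b :: 'm. a \<noteq> 1 \<Longrightarrow> b \<noteq> 1 \<Longrightarrow> a * b \<noteq> 1"
    and n: "n \<ge> 1" and m: "m \<ge> 1" and i: "i \<in> {1..n}"
    and p: "p \<in> gravity_cliques n" and q: "q \<in> gravity_cliques m"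
  shows "clique_comp n m i p q \<in> gravity_cliques (n + m - 1)"
proof -
  consider "n = 1" | "m = 1" | "n \<ge> 2" "m \<ge> 2" using n m by linarith
  then show ?thesis
  proof cases
    case 1
    then have "p = unit_clique" "i = 1" using p i by (auto simp: gravity_cliques_def cliques_def)
    then show ?thesis using 1 q clique_comp_unit_left[of q m] by (simp add: gravity_cliques_def)
  next
    case 2
    then have "q = unit_clique" using q by (auto simp: gravity_cliques_def cliques_def)
    then show ?thesis using 2 p clique_comp_unit_right[of p n i] by (simp add: gravity_cliques_def)
  next
    case 3
    then show ?thesis
      using p q clique_comp_closed[OF n m i, of p q]
        gravity_condition_clique_comp[OF mult 3 i, of p q]
      by (simp add: gravity_cliques_def)
  qed
qed

lemma D0_mult_not_unit: "a \<noteq> 1 \<Longrightarrow> b \<noteq> 1 \<Longrightarrow> a * b \<noteq> (1 :: D0)"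
  by (cases a; cases b) (simp_all add: one_D0_def)

lemma D0_eq_0_iff: "a = 0 \<longleftrightarrow> a \<noteq> (1 :: D0)"
  by (cases a) (simp_all add: one_D0_def zero_D0_def)

lemma set_operad_gravity_cliques:
  "set_operad (gravity_cliques :: nat \<Rightarrow> D0 clique set) unit_clique clique_comp"
proof (rule set_operad.set_operad_subset[OF set_operad_cliques])
  show "unit_clique \<in> (gravity_cliques 1 :: D0 clique set)"
    by (simp add: gravity_cliques_def gravity_condition_def unit_in_cliques del: One_nat_def)
  show "clique_comp n m i p q \<in> gravity_cliques (n + m - 1)"
    if "n \<ge> 1" "m \<ge> 1" "i \<in> {1..n}" "p \<in> gravity_cliques n" "q \<in> gravity_cliques m"
    for n m i and p q :: "D0 clique"
    by (rule clique_comp_gravity_cliques) (use D0_mult_not_unit that in blast)+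
qed (auto simp: gravity_cliques_def)

section \<open>Gravity chord diagrams\<close>

lemma clique_of_diagram_eq_1_iff: "a \<in> arcs n \<Longrightarrow> clique_of_diagram n c a = 1 \<longleftrightarrow> a \<notin> c"
  by (simp add: clique_of_diagram_def one_D0_def zero_D0_def)

text \<open>
  In arity 1 this fails: the clique whose only arc is solid satisfies \<open>gravity_condition 1\<close> but is not
  one of the cliques, and accordingly the only diagram of size 1 is the empty one.
\<close>

lemma gravity_diagrams_iff:
  assumes "n \<ge> 2"
  shows "c \<in> gravity_diagrams n \<longleftrightarrow> c \<subseteq> arcs n \<and> gravity_condition n (clique_of_diagram n c)"
proof -
  have 1: "edges n \<union> {base n} \<subseteq> arcs n"
    using assms by (auto simp: edges_def base_def arcs_def)
  have 2: "(x, y) \<in> arcs n \<and> (x', y') \<in> arcs n \<and> (x', y) \<in> arcs n"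
    if "(x, y) \<in> diagonals n" "(x', y') \<in> diagonals n" "crossing (x, y) (x', y')" "x < x'" for x y x' y'
    using that by (auto simp: diagonals_def arcs_def)
  have "(\<forall>a \<in> edges n \<union> {base n}. solid (clique_of_diagram n c) a) \<longleftrightarrow> edges n \<union> {base n} \<subseteq> c"
    using 1 clique_of_diagram_eq_1_iff[of _ n c] unfolding solid_def by blast
  moreover have "(\<forall>x y x' y'. (x, y) \<in> diagonals n \<and> (x', y') \<in> diagonals n \<and> crossing (x, y) (x', y')
      \<and> x < x' \<and> clique_of_diagram n c (x, y) \<noteq> 1 \<and> clique_of_diagram n c (x', y') \<noteq> 1
        \<longrightarrow> clique_of_diagram n c (x', y) = 1) \<longleftrightarrow>
      (\<forall>x y x' y'. (x, y) \<in> c \<inter> diagonals n \<and> (x', y') \<in> c \<inter> diagonals n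
         \<and> crossing (x, y) (x', y') \<and> x < x' \<longrightarrow> (x', y) \<notin> c)"
    using 2 clique_of_diagram_eq_1_iff[of _ n c] by (metis IntI IntD1 IntD2)
  ultimately show ?thesis
    using assms by (auto simp: gravity_diagrams_def gravity_condition_def)
qed

lemma clique_of_diagram_empty: "clique_of_diagram 1 {} = unit_clique"
  by (simp add: clique_of_diagram_def unit_clique_def)

lemma bij_betw_clique_of_diagram:
  assumes "n \<ge> 1"
  shows "bij_betw (clique_of_diagram n) (gravity_diagrams n) (gravity_cliques n)"
proof (cases "n = 1")
  case True
  moreover have "gravity_cliques 1 = {unit_clique :: D0 clique}"
    by (auto simp: gravity_cliques_def cliques_def gravity_condition_def)
  ultimately show ?thesis
    using clique_of_diagram_empty by (simp add: gravity_diagrams_def bij_betw_def)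
next
  case False
  then have n: "n \<ge> 2" using assms by simp
  have inv: "clique_of_diagram n {a \<in> arcs n. p a \<noteq> 1} = p" if "p \<in> cliques n" for p
    using cliques_extensional[OF that] D0_eq_0_iff
    by (auto simp: clique_of_diagram_def fun_eq_iff restrict_def extensional_def)
  show ?thesis
  proof (rule bij_betw_byWitness[where f' = "\<lambda>p. {a \<in> arcs n. p a \<noteq> 1}"])
    show "\<forall>c \<in> gravity_diagrams n. {a \<in> arcs n. clique_of_diagram n c a \<noteq> 1} = c"
    proof
      fix c assume "c \<in> gravity_diagrams n"
      then have "c \<subseteq> arcs n"
        by (simp add: gravity_diagrams_iff[OF n])
      then show "{a \<in> arcs n. clique_of_diagram n c a \<noteq> 1} = c"
        using clique_of_diagram_eq_1_iff by blast
    qed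
    show "\<forall>p \<in> gravity_cliques n. clique_of_diagram n {a \<in> arcs n. p a \<noteq> 1} = p"
      using inv by (simp add: gravity_cliques_def)
    show "clique_of_diagram n ` gravity_diagrams n \<subseteq> gravity_cliques n"
      using n by (auto simp: gravity_diagrams_iff gravity_cliques_def cliques_def
        clique_of_diagram_def)
    show "(\<lambda>p. {a \<in> arcs n. p a \<noteq> (1 :: D0)}) ` gravity_cliques n \<subseteq> gravity_diagrams n"
      using inv by (auto simp: gravity_diagrams_iff[OF n] gravity_cliques_def)
  qed
qed

text \<open>
  An arc is labeled in the composition if its preimage in \<open>c\<close> is labeled, which requires both ends to
  avoid the inner vertices of the glued polygon, or if its preimage in \<open>d\<close> is.
\<close>

lemma diagram_comp_Suc_iff:
  assumes "n \<ge> 2" "l \<ge> 1" and c: "c \<subseteq> arcs n" and d: "d \<subseteq> arcs (Suc l)"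
  shows "(x, y) \<in> diagram_comp n (Suc l) (Suc h) c d \<longleftrightarrow>
      (x \<le> h + 1 \<or> h + l + 2 \<le> x) \<and> (y \<le> h + 1 \<or> h + l + 2 \<le> y) \<and>
        (if x \<le> h + 1 then x else x - l, if y \<le> h + 1 then y else y - l) \<in> c
      \<or> h \<le> x \<and> h \<le> y \<and> (x - h, y - h) \<in> d"
proof -
  define r where "r x = (if x \<le> Suc h then x else x + Suc l - 1)" for x
  have 1: "z = r w \<longleftrightarrow> (z \<le> h + 1 \<or> h + l + 2 \<le> z) \<and> w = (if z \<le> h + 1 then z else z - l)" for z w
    by (auto simp: r_def)
  have 2: "z = w + Suc h - 1 \<longleftrightarrow> h \<le> z \<and> w = z - h" for z w
    by auto
  have "(x, y) \<in> map_prod r r ` c \<longleftrightarrow> (\<exists>u v. x = r u \<and> y = r v \<and> (u, v) \<in> c)"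
    by force
  moreover have "(x, y) \<in> map_prod (\<lambda>x. x + Suc h - 1) (\<lambda>x. x + Suc h - 1) ` d \<longleftrightarrow>
      (\<exists>u v. x = u + Suc h - 1 \<and> y = v + Suc h - 1 \<and> (u, v) \<in> d)"
    by force
  moreover have "diagram_comp n (Suc l) (Suc h) c d =
      map_prod r r ` c \<union> map_prod (\<lambda>x. x + Suc h - 1) (\<lambda>x. x + Suc h - 1) ` d"
    using assms(1,2) by (simp add: diagram_comp_def r_def[abs_def] Let_def)
  ultimately show ?thesis
    unfolding 1 2 by auto
qed

lemma clique_of_diagram_comp:
  assumes n: "n \<ge> 1" and m: "m \<ge> 1" and i: "i \<in> {1..n}"
    and c: "c \<in> gravity_diagrams n" and d: "d \<in> gravity_diagrams m"
  shows "clique_of_diagram (n + m - 1) (diagram_comp n m i c d)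
    = clique_comp n m i (clique_of_diagram n c) (clique_of_diagram m d)"
    and "diagram_comp n m i c d \<in> gravity_diagrams (n + m - 1)"
proof -
  let ?p = "clique_of_diagram n c" and ?q = "clique_of_diagram m d"
  have pq: "?p \<in> gravity_cliques n" "?q \<in> gravity_cliques m"
    using bij_betwE[OF bij_betw_clique_of_diagram] c d n m by blast+
  consider "n = 1" | "m = 1" "n \<noteq> 1" | "n \<ge> 2" "m \<ge> 2" using n m by linarith
  then have "clique_of_diagram (n + m - 1) (diagram_comp n m i c d) = clique_comp n m i ?p ?q
    \<and> diagram_comp n m i c d \<in> gravity_diagrams (n + m - 1)"
  proof cases
    case 1
    then have "?p = unit_clique" "i = 1" using pq i by (auto simp: gravity_cliques_def cliques_def)
    then show ?thesis
      using 1 d pq clique_comp_unit_left[of ?q m] by (simp add: gravity_cliques_def diagram_comp_def)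
  next
    case 2
    then have "?q = unit_clique" using pq by (auto simp: gravity_cliques_def cliques_def)
    then show ?thesis
      using 2 c pq clique_comp_unit_right[of ?p n i] by (simp add: gravity_cliques_def diagram_comp_def)
  next
    case 3
    obtain l h where l: "m = Suc l" and h: "i = Suc h" and lh: "l \<ge> 1" "h < n"
      using 3 i by (cases m; cases i) auto
    have cd: "c \<subseteq> arcs n" "d \<subseteq> arcs (Suc l)"
      using c d 3 l by (auto simp: gravity_diagrams_iff)
    have glue: "(h + 1, h + 2) \<in> c" "(1, l + 2) \<in> d"
    proof -
      have "(h + 1, h + 2) \<in> edges n \<union> {base n}" "(1, l + 2) \<in> edges m \<union> {base m}"
        using lh l by (auto simp: edges_def base_def)
      moreover have "edges n \<union> {base n} \<subseteq> c" "edges m \<union> {base m} \<subseteq> d"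
        using c d 3 by (simp_all add: gravity_diagrams_def)
      ultimately show "(h + 1, h + 2) \<in> c" "(1, l + 2) \<in> d"
        by blast+
    qed
    define e where "e = diagram_comp n (Suc l) (Suc h) c d"
    note mem = diagram_comp_Suc_iff[OF 3(1) lh(1) cd, of _ _ h, folded e_def]
    have c_arc: "1 \<le> u \<and> u < v \<and> v \<le> n + 1" if "(u, v) \<in> c" for u v
      using cd that by (auto simp: arcs_def)
    have d_arc: "1 \<le> u \<and> u < v \<and> v \<le> l + 2" if "(u, v) \<in> d" for u v
      using cd that by (auto simp: arcs_def)
    have p: "?p (u, v) = (if (u, v) \<in> c then 0 else 1)" if "1 \<le> u" "u < v" "v \<le> n + 1" for u v
      using that by (simp add: clique_of_diagram_def arcs_def)
    have q: "?q (u, v) = (if (u, v) \<in> d then 0 else 1)" if "1 \<le> u" "u < v" "v \<le> l + 2" for u v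
      using that l by (simp add: clique_of_diagram_def arcs_def)
    have e_arcs: "e \<subseteq> arcs (n + l)"
    proof (rule subrelI)
      fix x y assume "(x, y) \<in> e"
      then consider "(x - h, y - h) \<in> d"
        | "x \<le> h + 1 \<or> h + l + 2 \<le> x" "y \<le> h + 1 \<or> h + l + 2 \<le> y"
          "(if x \<le> h + 1 then x else x - l, if y \<le> h + 1 then y else y - l) \<in> c"
        unfolding mem by blast
      then show "(x, y) \<in> arcs (n + l)"
      proof cases
        case 1
        from d_arc[OF this] show ?thesis using lh by (auto simp: arcs_def)
      next
        case 2
        from c_arc[OF 2(3)] show ?thesis using lh 2(1,2) by (auto simp: arcs_def split: if_splits)
      qed
    qed
    have hom: "clique_of_diagram (n + l) e = clique_comp n (Suc l) (Suc h) ?p ?q"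
    proof (rule clique_ext)
      show "clique_of_diagram (n + l) e \<in> extensional (arcs (n + l))"
        by (simp add: clique_of_diagram_def)
      show "clique_comp n (Suc l) (Suc h) ?p ?q \<in> extensional (arcs (n + l))"
        using clique_comp_extensional[of n "Suc l"] by simp
      fix x y assume xy: "1 \<le> x" "x < y" "y \<le> n + l + 1"
      have e: "clique_of_diagram (n + l) e (x, y) = (if (x, y) \<in> e then 0 else 1)"
        using xy by (simp add: clique_of_diagram_def arcs_def)
      note val = clique_comp_Suc_apply[OF xy, of h ?p ?q]
      consider "y \<le> h + 1" | "x \<le> h" "h + l + 2 \<le> y" | "x \<le> h + 1" "h + l + 3 \<le> y"
        | "h + l + 2 \<le> x" | "h + 2 \<le> x" "y \<le> h + l + 2" | "h + 1 \<le> x" "y \<le> h + l + 1"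
        | "x = h + 1" "y = h + l + 2" | "x \<le> h" "h + 2 \<le> y" "y \<le> h + l + 1"
        | "h + 2 \<le> x" "x \<le> h + l + 1" "h + l + 3 \<le> y"
        using xy by linarith
      then show "clique_of_diagram (n + l) e (x, y) = clique_comp n (Suc l) (Suc h) ?p ?q (x, y)"
      proof cases
        case 1
        then show ?thesis unfolding e mem val(1)[OF 1] using xy lh
          by (subst p) (auto dest!: c_arc d_arc)
      next
        case 2
        then show ?thesis unfolding e mem val(2)[OF 2] using xy lh
          by (subst p) (auto dest!: c_arc d_arc)
      next
        case 3
        then show ?thesis unfolding e mem val(3)[OF 3] using xy lh
          by (subst p) (auto dest!: c_arc d_arc)
      next
        case 4
        then show ?thesis unfolding e mem val(4)[OF 4] using xy lh
          by (subst p) (auto dest!: c_arc d_arc)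
      next
        case 5
        then show ?thesis unfolding e mem val(5)[OF 5] using xy lh
          by (subst q) (auto dest!: c_arc d_arc)
      next
        case 6
        then show ?thesis unfolding e mem val(6)[OF 6] using xy lh
          by (subst q) (auto dest!: c_arc d_arc)
      next
        case 7
        then show ?thesis unfolding e mem val(7)[OF 7] using glue lh
          by (simp add: p q)
      next
        case 8
        then show ?thesis unfolding e mem val(8)[OF 8] using xy lh
          by (auto dest!: c_arc d_arc)
      next
        case 9
        then show ?thesis unfolding e mem val(9)[OF 9] using xy lh
          by (auto dest!: c_arc d_arc)
      qed
    qed
    have "clique_comp n m i ?p ?q \<in> gravity_cliques (n + m - 1)"
      by (rule clique_comp_gravity_cliques) (use D0_mult_not_unit n m i pq in blast)+
    then have "e \<in> gravity_diagrams (n + l)"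
      using gravity_diagrams_iff[of "n + l" e] e_arcs hom l h 3
      by (simp add: gravity_cliques_def)
    then show ?thesis
      using hom l h by (simp add: e_def)
  qed
  then show "clique_of_diagram (n + m - 1) (diagram_comp n m i c d) = clique_comp n m i ?p ?q"
    "diagram_comp n m i c d \<in> gravity_diagrams (n + m - 1)"
    by blast+
qed

lemma set_operad_gravity_diagrams: "set_operad gravity_diagrams {} diagram_comp"
  using set_operad_gravity_cliques
  by (rule set_operad.set_operad_pullback[where f = clique_of_diagram])
    (use bij_betw_clique_of_diagram clique_of_diagram_empty clique_of_diagram_comp in
      \<open>simp_all add: gravity_diagrams_def del: One_nat_def\<close>)

section \<open>The suboperad and the isomorphism\<close>

theorem proposition4p2p1:
  shows "suboperad
      (fscale :: 'k::field_char_0 \<Rightarrow> (D0 clique \<Rightarrow>\<^sub>0 'k) \<Rightarrow> (D0 clique \<Rightarrow>\<^sub>0 'k))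
      C_space C_unit C_comp gravity_space
    \<and> operads_isomorphic
      (fscale :: 'k \<Rightarrow> (diagram \<Rightarrow>\<^sub>0 'k) \<Rightarrow> (diagram \<Rightarrow>\<^sub>0 'k)) Grav_space Grav_unit Grav_comp
      (fscale :: 'k \<Rightarrow> (D0 clique \<Rightarrow>\<^sub>0 'k) \<Rightarrow> (D0 clique \<Rightarrow>\<^sub>0 'k)) gravity_space C_unit C_comp
    \<and> operad_isomorphism
      (fscale :: 'k \<Rightarrow> (diagram \<Rightarrow>\<^sub>0 'k) \<Rightarrow> (diagram \<Rightarrow>\<^sub>0 'k)) Grav_space Grav_unit Grav_comp
      (fscale :: 'k \<Rightarrow> (D0 clique \<Rightarrow>\<^sub>0 'k) \<Rightarrow> (D0 clique \<Rightarrow>\<^sub>0 'k)) gravity_space C_unit C_comp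
      phi_Grav"
proof -
  have C: "C_space = (\<lambda>n. lin_span (cliques n) :: (D0 clique \<Rightarrow>\<^sub>0 'k) set)"
    and C_unit: "(C_unit :: D0 clique \<Rightarrow>\<^sub>0 'k) = basis_vec unit_clique"
    and C_comp: "(C_comp :: _ \<Rightarrow> _ \<Rightarrow> _ \<Rightarrow> (D0 clique \<Rightarrow>\<^sub>0 'k) \<Rightarrow> _) = (\<lambda>n m i. bilinear_ext (clique_comp n m i))"
    and grav: "gravity_space = (\<lambda>n. lin_span (gravity_cliques n) :: (D0 clique \<Rightarrow>\<^sub>0 'k) set)"
    and G: "Grav_space = (\<lambda>n. lin_span (gravity_diagrams n) :: (diagram \<Rightarrow>\<^sub>0 'k) set)"
    and G_unit: "(Grav_unit :: diagram \<Rightarrow>\<^sub>0 'k) = basis_vec {}"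
    and G_comp: "(Grav_comp :: _ \<Rightarrow> _ \<Rightarrow> _ \<Rightarrow> (diagram \<Rightarrow>\<^sub>0 'k) \<Rightarrow> _) = (\<lambda>n m i. bilinear_ext (diagram_comp n m i))"
    and phi: "(phi_Grav :: _ \<Rightarrow> (diagram \<Rightarrow>\<^sub>0 'k) \<Rightarrow> _) = (\<lambda>n. linear_ext (clique_of_diagram n))"
    by (simp_all add: fun_eq_iff C_space_def C_unit_def C_comp_def gravity_space_def
        gravity_cliques_def Grav_space_def Grav_unit_def Grav_comp_def phi_Grav_def)
  note unfold = C C_unit C_comp grav G G_unit G_comp phi
  have iso: "operad_isomorphism
      (fscale :: 'k \<Rightarrow> (diagram \<Rightarrow>\<^sub>0 'k) \<Rightarrow> (diagram \<Rightarrow>\<^sub>0 'k)) Grav_space Grav_unit Grav_comp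
      (fscale :: 'k \<Rightarrow> (D0 clique \<Rightarrow>\<^sub>0 'k) \<Rightarrow> (D0 clique \<Rightarrow>\<^sub>0 'k)) gravity_space C_unit C_comp
      phi_Grav"
    unfolding unfold
    using set_operad_gravity_diagrams set_operad_gravity_cliques bij_betw_clique_of_diagram
      clique_of_diagram_empty clique_of_diagram_comp(1)
    by (rule operad_isomorphism_linear_ext)
  interpret sub: ns_operad "fscale :: 'k \<Rightarrow> (D0 clique \<Rightarrow>\<^sub>0 'k) \<Rightarrow> _" gravity_space C_unit C_comp
    using set_operad.ns_operad_lin_span[OF set_operad_gravity_cliques] by (simp add: unfold)
  have sub: "suboperad (fscale :: 'k \<Rightarrow> (D0 clique \<Rightarrow>\<^sub>0 'k) \<Rightarrow> (D0 clique \<Rightarrow>\<^sub>0 'k))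
      C_space C_unit C_comp gravity_space"
  proof (intro suboperad.intro suboperad_axioms.intro)
    show "ns_operad (fscale :: 'k \<Rightarrow> (D0 clique \<Rightarrow>\<^sub>0 'k) \<Rightarrow> _) C_space C_unit C_comp"
      using set_operad.ns_operad_lin_span[OF set_operad_cliques] by (simp add: unfold)
    show "gravity_space n \<subseteq> (C_space n :: (D0 clique \<Rightarrow>\<^sub>0 'k) set)" for n
      unfolding unfold by (rule lin_span_mono) (auto simp: gravity_cliques_def)
  qed (use sub.subspace_Op sub.unit_closed sub.pcomp_closed in simp_all)
  show ?thesis
    unfolding operads_isomorphic_def using sub iso by (intro conjI exI)
qed

end
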